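(* Let $s\in\mathbb C$ and $\delta>0$ be fixed. Then the derivative $\zeta_E'(s,q)=\frac{\partial}{\partial s}\zeta_E(s,q)$ has the asymptotic expansion $$\zeta_E'(s,q)\sim\frac14 q^{-s-1}-\zeta_E(s,q)\log q-\frac12\sum_{k=1}^\infty E_{2k+1}(0)\sum_{j=0}^{2k}\frac{(s)_j}{j!\,(2k-j+1)}\,q^{-s-2k-1}$$ as $|q|\to\infty$ in the sector $|\arg q|\le\pi-\delta$.
   Context: For $|\arg q|<\pi$, $\zeta_E(s,q)$ denotes the alternating Hurwitz zeta function, defined for $\mathrm{Re}(s)>0$ by $\zeta_E(s,q)=\sum_{n=0}^\infty \frac{(-1)^n}{(n+q)^s}$ (principal branches) and extended to an entire function of $s\in\mathbb C$ by analytic continuation. $E_n(x)$ are the Euler polynomials, $\frac{2e^{xt}}{e^t+1}=\sum_{n\ge0}E_n(x)\frac{t^n}{n!}$ for $|t|<\pi$. $(s)_k=s(s+1)\cdots(s+k-1)$, $(s)_0=1$. Powers and $\log q$ are principal values. The symbol $\sim$ means asymptotic expansion in the Poincaré sense: for each integer $K\ge0$, the difference between the left side and the right side with the infinite series in $k$ truncated after $k=K$ is $O(|q|^{-\mathrm{Re}(s)-2K-3})$ as $|q|\to\infty$ in the sector, the implied constant depending only on $s,\delta,K$. *)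

theory Defs
  imports "HOL-Complex_Analysis.Complex_Analysis"
begin

text \<open>
  Euler polynomials, with the exponential generating function \<open>2 exp (x t) / (exp t + 1)\<close> read as
  a formal power series in \<open>t\<close>; lemma \<open>euler_poly_sums\<close> is the analytic version.
\<close>

definition euler_poly :: "nat \<Rightarrow> complex \<Rightarrow> complex" where
  "euler_poly n x = fact n * fps_nth (2 * fps_exp x / (fps_exp 1 + 1)) n"

lemma exp_plus_one_nonzero:
  fixes t :: complex
  assumes "norm t < pi"
  shows "exp t + 1 \<noteq> 0"
proof
  assume "exp t + 1 = 0"
  hence "exp t = exp (\<i> * of_real pi)"
    by (simp add: eq_neg_iff_add_eq_0)
  then obtain n :: int where "t = \<i> * of_real pi + (of_int (2 * n) * pi) * \<i>"
    unfolding exp_eq by auto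
  hence "Im t = of_int (1 + 2 * n) * pi"
    by (simp add: algebra_simps)
  moreover have "\<bar>of_int (1 + 2 * n)\<bar> \<ge> (1 :: real)"
  proof -
    have "\<bar>1 + 2 * n\<bar> \<ge> 1"
      by arith
    thus ?thesis
      by (simp only: of_int_abs [symmetric] of_int_1_le_iff)
  qed
  ultimately have "\<bar>Im t\<bar> \<ge> 1 * pi"
    by (simp only: abs_mult abs_of_pos [OF pi_gt_zero] mult_right_mono [OF _ pi_ge_zero])
  with abs_Im_le_cmod[of t] assms show False
    by simp
qed

lemma euler_poly_sums:
  fixes t x :: complex
  assumes "norm t < pi"
  shows "(\<lambda>n. euler_poly n x * t ^ n / fact n) sums (2 * exp (x * t) / (exp t + 1))"
proof -
  let ?f = "\<lambda>t. 2 * exp (x * t) / (exp t + 1)"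
  have "?f has_fps_expansion (2 * fps_exp x / (fps_exp 1 + 1))"
    by (intro fps_expansion_intros) auto
  hence "fps_nth (2 * fps_exp x / (fps_exp 1 + 1)) n = (deriv ^^ n) ?f 0 / fact n" for n
    by (rule fps_nth_fps_expansion)
  moreover have "?f holomorphic_on ball 0 pi"
    using exp_plus_one_nonzero by (intro holomorphic_intros) auto
  hence "(\<lambda>n. (deriv ^^ n) ?f 0 / fact n * (t - 0) ^ n) sums ?f t"
    by (rule holomorphic_power_series) (use assms in auto)
  ultimately show ?thesis
    by (simp add: euler_poly_def)
qed

text \<open>
  For \<open>q \<notin> \<real>\<^sub>\<le>\<^sub>0\<close>, \<open>\<lambda>s. zeta_E s q\<close> is the entire function continuing the
  alternating Hurwitz series from \<open>Re s > 0\<close>, unique by the identity theorem. The series converges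
  only conditionally for \<open>Re s \<le> 1\<close>, hence ordered summation. For all other \<open>q\<close> the value carries
  no meaning.
\<close>

definition zeta_E :: "complex \<Rightarrow> complex \<Rightarrow> complex" where
  "zeta_E s q = (THE f. f holomorphic_on UNIV \<and>
     (\<forall>z. Re z > 0 \<longrightarrow> (\<lambda>n. (-1) ^ n / (of_nat n + q) powr z) sums f z)) s"

end

theory Submission
  imports Defs
begin

text \<open>
  Let \<open>a\<^sub>n\<close> be the Taylor coefficients of \<open>2 - 2 / (exp t + 1) = 2 / (1 + exp (- t))\<close>, so that
  \<open>a\<^sub>n = - E\<^sub>n(0) / n!\<close> for \<open>n > 0\<close>, and put
  \<open>g\<^sub>N(z,q) = 1/2 (\<Sum>n\<le>N. a\<^sub>n (z)\<^sub>n q\<^bsup>-z-n\<^esup>)\<close>. The recurrence for \<open>a\<^sub>n\<close> makes the defect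
  \<open>h\<^sub>N(z,q) = q\<^bsup>-z\<^esup> - g\<^sub>N(z,q) - g\<^sub>N(z,q+1)\<close> of order \<open>q\<^bsup>-z-N-1\<^esup>\<close>, locally uniformly in \<open>z\<close>.
  Hence \<open>g\<^sub>N(z,q) + (\<Sum>n. (-1)\<^sup>n h\<^sub>N(z,q+n))\<close> converges for \<open>Re z > 1 - N\<close>, and by telescoping it
  equals the alternating Hurwitz series wherever that converges: it is the analytic continuation of
  \<open>\<zeta>\<^sub>E\<close>. Two powers of \<open>q\<close> are lost on summing the defects, so \<open>N\<close> is taken larger than the
  order wanted. The resulting bound for \<open>q\<^sup>z \<zeta>\<^sub>E(z,q) - 1/2 (\<Sum>n\<le>m. a\<^sub>n (z)\<^sub>n q\<^bsup>-n\<^esup>)\<close> is uniform for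
  \<open>z\<close> in a disc around \<open>s\<close>, so by Cauchy's inequality it can be differentiated in \<open>z\<close>; the
  factor \<open>q\<^sup>z\<close> produces the term with the logarithm.
\<close>

subsection \<open>Coefficients\<close>

text \<open>The generating function equals \<open>2 / (1 + exp (- t))\<close>, so these numbers are
  E_n(1)/n! = (-1)^n E_n(0)/n!. The sign (-1)^n produced by differentiating q^(-z) n times is thus
  absorbed.\<close>

definition boole_coeff :: "nat \<Rightarrow> complex" where
  "boole_coeff n = fps_nth (2 - 2 / (fps_exp 1 + 1)) n"

text \<open>The denominator has constant coefficient 2, hence is a unit, and the formal quotient is
  exact.\<close>

lemma euler_fps_times: "2 / (fps_exp (1::complex) + 1) * (fps_exp 1 + 1) = 2"
  by (rule dvd_div_mult_self, rule unit_imp_dvd) (simp add: fps_is_unit_iff)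

lemma boole_fps_times:
  "(2 - 2 / (fps_exp (1::complex) + 1)) * (1 + fps_exp (- 1)) = 2"
proof -
  let ?e = "fps_exp (1::complex)" and ?f = "fps_exp (-1::complex)"
  have "?f * ?e = 1"
    by (simp flip: fps_exp_add_mult)
  hence "(?e + 1) * ?f = 1 + ?f"
    by (simp add: algebra_simps)
  hence B: "2 / (?e + 1) * (1 + ?f) = 2 * ?f"
    using euler_fps_times by (metis mult.assoc)
  show ?thesis
    unfolding left_diff_distrib B by (simp add: algebra_simps)
qed

text \<open>Compares the coefficients of t^m in \<open>?A + ?A * fps_exp (-1) = 2\<close>. This
  relation is what cancels the low orders of the defect.\<close>

lemma boole_coeff_recurrence:
  "boole_coeff m + (\<Sum>n\<le>m. boole_coeff n * ((-1) ^ (m - n) / fact (m - n))) = (if m = 0 then 2 else 0)"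
proof -
  let ?A = "2 - 2 / (fps_exp (1::complex) + 1)"
  have "fps_nth (?A + ?A * fps_exp (-1)) m = fps_nth 2 m"
    using boole_fps_times by (simp add: algebra_simps)
  thus ?thesis
    by (simp add: fps_mult_nth boole_coeff_def atMost_atLeast0 numeral_fps_const)
qed

lemma boole_coeff_eq_euler_poly:
  assumes "n > 0"
  shows "boole_coeff n = - euler_poly n 0 / fact n"
  using assms by (simp add: boole_coeff_def euler_poly_def numeral_fps_const)

text \<open>With B(t) = 2/(e^t + 1) one has B(-t) = 2 - B(t), so B - 1 is odd. The reflection
  formula is obtained by cancelling the factor 1 + e^(-t).\<close>

lemma boole_coeff_even_eq_0:
  assumes "even n" "n > 0"
  shows "boole_coeff n = 0"
proof -
  define B where "B = 2 / (fps_exp (1::complex) + 1)"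
  have "B * (fps_exp 1 + 1) = 2"
    unfolding B_def by (rule euler_fps_times)
  hence "(B * (fps_exp 1 + 1)) oo (- fps_X) = 2 oo (- fps_X)"
    by simp
  moreover have "fps_exp (1::complex) oo - fps_X = fps_exp (-1)"
    by (simp add: fps_compose_uminus' fps_eq_iff)
  ultimately have "(B oo - fps_X) * (fps_exp (-1) + 1) = 2"
    by (simp add: fps_compose_mult_distrib fps_compose_add_distrib numeral_fps_const)
  hence "(B oo - fps_X) * (1 + fps_exp (-1)) = (2 - B) * (1 + fps_exp (- 1))"
    using boole_fps_times by (simp add: add.commute B_def)
  moreover have "1 + fps_exp (-1 :: complex) \<noteq> 0"
    by (metis boole_fps_times mult_zero_right zero_neq_numeral)
  ultimately have "B oo - fps_X = 2 - B"
    by simp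
  hence "fps_nth (B oo - fps_X) n = fps_nth (2 - B) n" by simp
  thus ?thesis using assms
    by (simp add: boole_coeff_def flip: B_def) (simp add: numeral_fps_const fps_compose_uminus')
qed

lemma boole_coeff_0: "boole_coeff 0 = 1"
  using boole_coeff_recurrence[of 0] by simp

lemma boole_coeff_1: "boole_coeff 1 = 1/2"
  using boole_coeff_recurrence[of 1] boole_coeff_0 by (simp add: field_simps)

section \<open>Rising factorials: domination, binomial remainders, derivative\<close>

lemma pochhammer_nonneg_real:
  fixes x :: real
  assumes "x \<ge> 0"
  shows "pochhammer x n \<ge> 0"
  unfolding pochhammer_prod by (intro prod_nonneg) (use assms in auto)

lemma norm_pochhammer_le:
  fixes w :: complex
  assumes "norm w \<le> R"
  shows "norm (pochhammer w n) \<le> pochhammer R n"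
  unfolding pochhammer_prod prod_norm [symmetric]
  by (intro prod_mono) (use assms in \<open>auto intro!: norm_triangle_le\<close>)

text \<open>Each coefficient is dominated by that of the binomial series of (1 - x)^(-R), which
  converges at x = 1/2; this makes \<open>C\<close> uniform in both \<open>u\<close> and
  \<open>w\<close>.\<close>

lemma powr_taylor_remainder:
  fixes R :: real and M :: nat
  assumes "R \<ge> 0"
  obtains C where "C \<ge> 0" "\<And>u w. norm u \<le> 1/2 \<Longrightarrow> norm w \<le> R \<Longrightarrow>
    norm ((1 + u) powr (- w) - (\<Sum>j<M. (-1) ^ j * pochhammer w j / fact j * u ^ j)) \<le> C * norm (u::complex) ^ M"
proof -
  define b where "b n = pochhammer R n / fact n * (1/2) ^ n" for n
  have b_nonneg: "b n \<ge> 0" for n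
    using assms by (simp add: b_def pochhammer_nonneg_real)
  have "summable (\<lambda>n. (-R gchoose n) * (-1/2) ^ n)"
    using gen_binomial_real[of "-1/2" "-R"] by (auto simp: sums_iff)
  also have "(\<lambda>n. (-R gchoose n) * (-1/2) ^ n) = b"
    by (simp add: b_def gbinomial_pochhammer power_minus' field_simps fun_eq_iff flip: power_mult_distrib)
  finally have sb: "summable b" .
  \<comment> \<open>The terms of \<open>b\<close> carry (1/2)^(n+M), but in the estimate only |u|^n
    is replaced by (1/2)^n while |u|^M is kept; the factor 2^M makes up for this.\<close>
  define C where "C = 2 ^ M * (\<Sum>n. b (n + M))"
  have sbM: "summable (\<lambda>n. b (n + M))" using sb by (simp add: summable_iff_shift)
  show ?thesis
  proof
    show "C \<ge> 0" unfolding C_def by (intro mult_nonneg_nonneg suminf_nonneg sbM b_nonneg) auto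
  next
    fix u w :: complex
    assume u: "norm u \<le> 1/2" and w: "norm w \<le> R"
    define f where "f n = (-1) ^ n * pochhammer w n / fact n * u ^ n" for n
    have "(\<lambda>n. (-w gchoose n) * u ^ n) sums (1 + u) powr (-w)"
      by (rule gen_binomial_complex) (use u in simp)
    hence f: "f sums (1 + u) powr (-w)"
      by (simp add: f_def [abs_def] gbinomial_pochhammer)
    have bound: "norm (f (n + M)) \<le> 2 ^ M * b (n + M) * norm u ^ M" for n
    proof -
      have "norm (f (n + M)) = norm (pochhammer w (n + M)) / fact (n + M) * (norm u ^ n * norm u ^ M)"
        by (simp add: f_def norm_mult norm_divide norm_power power_add)
      also have "\<dots> \<le> pochhammer R (n + M) / fact (n + M) * ((1/2) ^ n * norm u ^ M)"
        using u w assms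
        by (intro mult_mono divide_right_mono norm_pochhammer_le power_mono) (auto simp: pochhammer_nonneg_real)
      also have "\<dots> = 2 ^ M * b (n + M) * norm u ^ M"
        by (simp add: b_def power_add field_simps)
      finally show ?thesis .
    qed
    have s: "summable (\<lambda>n. 2 ^ M * b (n + M) * norm u ^ M)"
      by (intro summable_mult summable_mult2 sbM)
    have "(1 + u) powr (-w) - (\<Sum>j<M. f j) = (\<Sum>n. f (n + M))"
      using f by (simp add: sums_iff suminf_minus_initial_segment)
    also have "norm \<dots> \<le> (\<Sum>n. 2 ^ M * b (n + M) * norm u ^ M)"
      by (rule norm_suminf_le) (use bound s in auto)
    also have "\<dots> = C * norm u ^ M"
      using sbM by (simp add: C_def suminf_mult suminf_mult2 [symmetric] summable_mult)
    finally show "norm ((1 + u) powr (- w) - (\<Sum>j<M. (-1) ^ j * pochhammer w j / fact j * u ^ j)) \<le> C * norm u ^ M"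
      by (simp add: f_def)
  qed
qed

text \<open>The sum is the coefficient of x^n in -log(1-x) (1-x)^(-s), the s-derivative of
  (1-x)^(-s). The proof is an induction resting on (n+1) T(n+1) = (n+s) T(n) + (s)_n/n!.\<close>

lemma pochhammer_has_field_derivative:
  fixes s :: complex
  shows "((\<lambda>z. pochhammer z n) has_field_derivative
    fact n * (\<Sum>j<n. pochhammer s j / (fact j * of_nat (n - j)))) (at s)"
proof (induction n)
  case (Suc n)
  define T where "T n = (\<Sum>j<n. pochhammer s j / (fact j * of_nat (n - j)))" for n
  \<comment> \<open>Splits n + s = (s + j) + (n - j): the first part lengthens the rising factorial,
    the second cancels the denominator.\<close>
  have "(of_nat n + s) * T n = (\<Sum>j<n. pochhammer s (Suc j) / (fact j * of_nat (n - j)) + pochhammer s j / fact j)"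
    unfolding T_def sum_distrib_left
  proof (rule sum.cong)
    fix j assume "j \<in> {..<n}"
    thus "(of_nat n + s) * (pochhammer s j / (fact j * of_nat (n - j))) =
       pochhammer s (Suc j) / (fact j * of_nat (n - j)) + pochhammer s j / fact j"
      by (simp add: pochhammer_Suc field_simps of_nat_diff)
  qed auto
  also have "\<dots> = (\<Sum>j<n. pochhammer s (Suc j) / (fact j * of_nat (n - j))) + (\<Sum>j<n. pochhammer s j / fact j)"
    by (rule sum.distrib)
  \<comment> \<open>After the shift from j to j + 1 the weight j makes the new term at j = 0
    vanish.\<close>
  also have "(\<Sum>j<n. pochhammer s (Suc j) / (fact j * of_nat (n - j))) = 
      (\<Sum>j<Suc n. of_nat j * pochhammer s j / (fact j * of_nat (Suc n - j)))"
    unfolding sum.lessThan_Suc_shift by (simp add: divide_simps del: of_nat_Suc)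
  finally have "(of_nat n + s) * T n + pochhammer s n / fact n = 
     (\<Sum>j<Suc n. of_nat j * pochhammer s j / (fact j * of_nat (Suc n - j)) + pochhammer s j / fact j)"
    by (simp add: sum.distrib)
  also have "\<dots> = of_nat (Suc n) * T (Suc n)"
    unfolding T_def sum_distrib_left
  proof (rule sum.cong)
    fix j assume j: "j \<in> {..<Suc n}"
    define d :: complex where "d = of_nat (Suc n - j)"
    have "d \<noteq> 0" "of_nat (Suc n) = of_nat j + d"
      using j by (auto simp: d_def simp del: of_nat_Suc simp flip: of_nat_add)
    thus "of_nat j * pochhammer s j / (fact j * of_nat (Suc n - j)) + pochhammer s j / fact j =
       of_nat (Suc n) * (pochhammer s j / (fact j * of_nat (Suc n - j)))"
      unfolding d_def [symmetric] by (simp add: field_simps del: of_nat_Suc)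
  qed auto
  finally have "of_nat (Suc n) * T (Suc n) = (of_nat n + s) * T n + pochhammer s n / fact n" ..
  hence *: "fact (Suc n) * T (Suc n) = fact n * T n * (s + of_nat n) + pochhammer s n"
    by (simp add: field_simps)
  have "((\<lambda>z. pochhammer z n * (z + of_nat n)) has_field_derivative
          fact n * T n * (s + of_nat n) + pochhammer s n) (at s)"
    using Suc unfolding T_def by (auto intro!: derivative_eq_intros)
  thus ?case
    unfolding * [symmetric] unfolding T_def pochhammer_Suc .
qed simp

subsection \<open>The defect of a truncated expansion\<close>

definition boole_sum :: "nat \<Rightarrow> complex \<Rightarrow> complex \<Rightarrow> complex" where
  "boole_sum N z q = 1/2 * (\<Sum>n\<le>N. boole_coeff n * pochhammer z n * q powr (- z - of_nat n))"

definition boole_defect :: "nat \<Rightarrow> complex \<Rightarrow> complex \<Rightarrow> complex" where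
  "boole_defect N z q = q powr (- z) - boole_sum N z q - boole_sum N z (q + 1)"

text \<open>Terms are collected by total degree m = n + j. Since (z)_n (z+n)_(m-n) = (z)_m, the
  coefficient of u^m is (z)_m times the left side of \<open>boole_coeff_recurrence\<close>. The
  cut-off j < N+1-n keeps exactly the pairs with n + j <= N.\<close>

lemma boole_sum_cancellation:
  fixes z u :: complex
  shows "(\<Sum>n\<le>N. boole_coeff n * pochhammer z n * u ^ n) +
    (\<Sum>n\<le>N. boole_coeff n * pochhammer z n * u ^ n *
      (\<Sum>j<N+1-n. (-1) ^ j * pochhammer (z + of_nat n) j / fact j * u ^ j)) = 2"
proof -
  define f where "f n j = boole_coeff n * pochhammer z n * u ^ n * 
     ((-1) ^ j * pochhammer (z + of_nat n) j / fact j * u ^ j)" for n j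
  have "(\<Sum>n\<le>N. \<Sum>j<N+1-n. f n j) = (\<Sum>(n,j)\<in>(SIGMA n:{..N}. {..<N+1-n}). f n j)"
    by (rule sum.Sigma) auto
  also have "(SIGMA n:{..N}. {..<N+1-n}) = {(n, j). n + j \<le> N}"
    by auto
  also have "(\<Sum>(n,j)\<in>\<dots>. f n j) = (\<Sum>m\<le>N. \<Sum>n\<le>m. f n (m - n))"
    by (rule sum.triangle_reindex_eq)
  also have "\<dots> = (\<Sum>m\<le>N. pochhammer z m * u ^ m * 
      (\<Sum>n\<le>m. boole_coeff n * ((-1) ^ (m - n) / fact (m - n))))"
  proof (rule sum.cong [OF refl])
    fix m
    show "(\<Sum>n\<le>m. f n (m - n)) = pochhammer z m * u ^ m * 
      (\<Sum>n\<le>m. boole_coeff n * ((-1) ^ (m - n) / fact (m - n)))"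
      unfolding sum_distrib_left
    proof (rule sum.cong [OF refl])
      fix n assume "n \<in> {..m}"
      hence *: "pochhammer z m = pochhammer z n * pochhammer (z + of_nat n) (m - n)"
        "u ^ m = u ^ n * u ^ (m - n)"
        by (auto simp: pochhammer_product simp flip: power_add)
      show "f n (m - n) = pochhammer z m * u ^ m * (boole_coeff n * ((-1) ^ (m - n) / fact (m - n)))"
        unfolding f_def * by (simp add: mult_ac)
    qed
  qed
  finally have "(\<Sum>n\<le>N. boole_coeff n * pochhammer z n * u ^ n) + (\<Sum>n\<le>N. \<Sum>j<N+1-n. f n j) =
     (\<Sum>m\<le>N. pochhammer z m * u ^ m * (boole_coeff m + 
      (\<Sum>n\<le>m. boole_coeff n * ((-1) ^ (m - n) / fact (m - n)))))"
    by (simp add: sum.distrib [symmetric] algebra_simps)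
  also have "\<dots> = (\<Sum>m\<le>N. if m = 0 then 2 else 0)"
    unfolding boole_coeff_recurrence by (intro sum.cong) auto
  also have "\<dots> = 2" by simp
  finally show ?thesis by (simp add: f_def sum_distrib_left)
qed

section \<open>Principal powers and the size of the defect\<close>

text \<open>For non-real q the numbers q and 1 + 1/q lie in opposite half-planes, so their arguments
  have opposite signs and the sum stays in the principal range. On the positive axis both arguments
  vanish.\<close>

lemma powr_add_1:
  fixes q w :: complex
  assumes "q \<notin> \<real>\<^sub>\<le>\<^sub>0"
  shows "(q + 1) powr w = q powr w * (1 + 1 / q) powr w"
proof -
  have q: "q \<noteq> 0" using assms by auto
  have q1: "1 + 1 / q \<noteq> 0"
  proof
    assume "1 + 1 / q = 0"
    hence "q = -1" using q by (simp add: field_simps add_eq_0_iff)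
    thus False using assms by simp
  qed
  have Im_inv: "Im (1 + 1 / q) = - Im q / (norm q)\<^sup>2"
    by (simp add: Im_divide cmod_power2)
  have sgn: "0 \<le> Im (Ln w) \<longleftrightarrow> 0 \<le> Im w" if "w \<noteq> 0" for w
    using Im_Ln_pos_le[OF that] Im_Ln_le_pi[OF that] by auto
  have "-pi < Im (Ln q) + Im (Ln (1 + 1/q)) \<and> Im (Ln q) + Im (Ln (1 + 1/q)) \<le> pi"
  proof (cases "Im q" "0 :: real" rule: linorder_cases)
    case equal
    hence "Re q > 0" "q = of_real (Re q)"
      using assms by (auto simp: complex_nonpos_Reals_iff complex_eq_iff)
    then obtain x where x: "q = of_real x" "x > 0" by metis
    have "1 + 1 / q = of_real (1 + 1 / x)" using x by simp
    moreover have "1 + 1 / x > 0" using x by (simp add: add_pos_pos)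
    ultimately have "Im (Ln (1 + 1/q)) = 0" by (metis Ln_of_real Im_complex_of_real)
    moreover have "Im (Ln q) = 0" using x by (simp add: Ln_of_real)
    ultimately show ?thesis by simp
  next
    case greater
    hence "Im (1 + 1/q) < 0" using q unfolding Im_inv by (simp add: divide_neg_pos)
    thus ?thesis
      using Im_Ln_le_pi[OF q] mpi_less_Im_Ln[OF q1] sgn[OF q] sgn[OF q1] greater by linarith
  next
    case less
    hence "Im (1 + 1/q) > 0" using q unfolding Im_inv by (simp add: divide_neg_pos)
    thus ?thesis
      using Im_Ln_le_pi[OF q1] mpi_less_Im_Ln[OF q] sgn[OF q] sgn[OF q1] less by linarith
  qed
  hence "Ln (q * (1 + 1 / q)) = Ln q + Ln (1 + 1 / q)"
    using q q1 by (intro Ln_times_simple) auto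
  moreover have "q * (1 + 1 / q) = q + 1" using q by (simp add: field_simps)
  moreover have "q + 1 \<noteq> 0" using assms by (auto simp: add_eq_0_iff2)
  ultimately show ?thesis
    using q q1 by (simp add: powr_def exp_add algebra_simps)
qed

text \<open>The argument contributes at most exp(pi |Im w|), so complex powers compare with real
  ones uniformly for \<open>w\<close> in bounded sets.\<close>

lemma norm_powr_le:
  fixes q w :: complex
  shows "norm (q powr w) \<le> norm q powr Re w * exp (pi * norm w)"
proof -
  have "- Im w * Arg q \<le> \<bar>Im w\<bar> * \<bar>Arg q\<bar>"
    by (metis abs_ge_self abs_minus_cancel abs_mult mult_minus_left)
  also have "\<dots> \<le> norm w * pi"
    using Arg_bounded[of q] by (intro mult_mono abs_Im_le_cmod) auto
  finally show ?thesis
    unfolding norm_powr_complex by (intro mult_left_mono) (auto simp: mult.commute)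
qed

lemma powr_minus_of_nat:
  fixes q z :: complex
  assumes "q \<noteq> 0"
  shows "q powr (- z - of_nat n) = q powr (- z) * (1 / q) ^ n"
  unfolding powr_diff using assms by (simp add: powr_nat' power_one_over)

text \<open>Once q^(-z) is factored out, everything is expressed in u = 1/q. The Taylor polynomials
  cancel by \<open>boole_sum_cancellation\<close>; each summand keeps u^n times a binomial remainder
  of order u^(N+1-n), hence u^(N+1).\<close>

lemma boole_defect_bound:
  fixes R :: real and N :: nat
  assumes "R \<ge> 0"
  obtains C where "C \<ge> 0" "\<And>z q. norm z \<le> R \<Longrightarrow> norm q \<ge> 2 \<Longrightarrow> q \<notin> \<real>\<^sub>\<le>\<^sub>0 \<Longrightarrow>
     norm (boole_defect N z q) \<le> C * norm q powr (- Re z - real N - 1)"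
proof -
  \<comment> \<open>The radius R + N covers all exponents z + n with n <= N; the predicate allows a
    constant to be chosen for every order \<open>M\<close> at once.\<close>
  define P where "P M C \<longleftrightarrow> C \<ge> 0 \<and> (\<forall>u w. norm u \<le> 1/2 \<longrightarrow> norm w \<le> R + N \<longrightarrow>
    norm ((1 + u) powr (- w) - (\<Sum>j<M. (-1) ^ j * pochhammer w j / fact j * u ^ j)) \<le> C * norm (u::complex) ^ M)"
    for M :: nat and C :: real
  have "\<exists>C. P M C" for M
    by (rule powr_taylor_remainder[of "R + N" M]) (use assms in \<open>auto simp: P_def\<close>)
  then obtain c where "\<And>M. P M (c M)"
    by metis
  hence c: "\<And>M. c M \<ge> 0" and rem: "\<And>M u w. norm u \<le> 1/2 \<Longrightarrow> norm w \<le> R + N \<Longrightarrow>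
    norm ((1 + u) powr (- w) - (\<Sum>j<M. (-1) ^ j * pochhammer w j / fact j * u ^ j)) \<le> c M * norm (u::complex) ^ M"
    unfolding P_def by blast+
  define C where "C = exp (pi * R) * (1/2 * (\<Sum>n\<le>N. norm (boole_coeff n) * pochhammer R n * c (N+1-n)))"
  show ?thesis
  proof
    show "C \<ge> 0"
      unfolding C_def by (intro mult_nonneg_nonneg sum_nonneg c pochhammer_nonneg_real assms) auto
  next
    fix z q :: complex
    assume z: "norm z \<le> R" and q: "norm q \<ge> 2" "q \<notin> \<real>\<^sub>\<le>\<^sub>0"
    have q0: "q \<noteq> 0" using q by auto
    define u where "u = 1 / q"
    have u: "norm u \<le> 1/2" using q q0 by (simp add: u_def norm_divide field_simps)
    define e where "e n = (1 + u) powr (- (z + of_nat n)) - 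
       (\<Sum>j<N+1-n. (-1) ^ j * pochhammer (z + of_nat n) j / fact j * u ^ j)" for n
    define b where "b n = boole_coeff n * pochhammer z n * u ^ n" for n
    have g: "boole_sum N z q = q powr (-z) * (1/2 * (\<Sum>n\<le>N. b n))"
      unfolding boole_sum_def powr_minus_of_nat[OF q0] u_def [symmetric] b_def
      by (simp add: sum_distrib_left mult_ac)
    have g1: "boole_sum N z (q + 1) = q powr (-z) * (1/2 * (\<Sum>n\<le>N. b n * (1 + u) powr (- (z + of_nat n))))"
      unfolding boole_sum_def powr_add_1[OF q(2)] powr_minus_of_nat[OF q0] u_def [symmetric] b_def
      by (simp add: sum_distrib_left mult_ac)
    have "boole_defect N z q = q powr (-z) * 
        (1 - 1/2 * ((\<Sum>n\<le>N. b n) + (\<Sum>n\<le>N. b n * (1 + u) powr (- (z + of_nat n)))))"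
      unfolding boole_defect_def g g1 by (simp add: algebra_simps)
    also have "(\<Sum>n\<le>N. b n) + (\<Sum>n\<le>N. b n * (1 + u) powr (- (z + of_nat n))) = 
        2 + (\<Sum>n\<le>N. b n * e n)"
      using boole_sum_cancellation[of z u N]
      by (simp add: e_def b_def right_diff_distrib sum_subtractf algebra_simps)
    finally have "boole_defect N z q = - (q powr (-z) * (1/2 * (\<Sum>n\<le>N. b n * e n)))"
      by (simp add: field_simps)
    hence "norm (boole_defect N z q) = norm (q powr (-z)) * (1/2 * norm (\<Sum>n\<le>N. b n * e n))"
      by (simp add: norm_mult norm_divide)
    also have "\<dots> \<le> (norm q powr (- Re z) * exp (pi * R)) * 
       (1/2 * (\<Sum>n\<le>N. norm (boole_coeff n) * pochhammer R n * c (N+1-n) * norm u ^ (N+1)))"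
    proof (intro mult_mono)
      have "norm (q powr (-z)) \<le> norm q powr (- Re z) * exp (pi * norm z)"
        using norm_powr_le[of q "-z"] by simp
      also have "\<dots> \<le> norm q powr (- Re z) * exp (pi * R)"
        using z by (intro mult_left_mono) auto
      finally show "norm (q powr (-z)) \<le> norm q powr (- Re z) * exp (pi * R)" .
      show "norm (\<Sum>n\<le>N. b n * e n) \<le> (\<Sum>n\<le>N. norm (boole_coeff n) * pochhammer R n * c (N+1-n) * norm u ^ (N+1))"
      proof (rule sum_norm_le)
        fix n assume n: "n \<in> {..N}"
        have "norm (z + of_nat n) \<le> R + N"
          using z n by (intro norm_triangle_le) auto
        hence "norm (e n) \<le> c (N+1-n) * norm u ^ (N+1-n)"
          unfolding e_def by (intro rem u)
        hence "norm (b n * e n) \<le> (norm (boole_coeff n) * pochhammer R n * norm u ^ n) * (c (N+1-n) * norm u ^ (N+1-n))"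
          unfolding norm_mult b_def norm_power using z assms
          by (intro mult_mono norm_pochhammer_le mult_nonneg_nonneg pochhammer_nonneg_real) auto
        also have "\<dots> = norm (boole_coeff n) * pochhammer R n * c (N+1-n) * (norm u ^ n * norm u ^ (N+1-n))"
          by (simp add: mult_ac)
        also have "norm u ^ n * norm u ^ (N+1-n) = norm u ^ (N+1)"
          using n by (simp flip: power_add)
        finally show "norm (b n * e n) \<le> norm (boole_coeff n) * pochhammer R n * c (N+1-n) * norm u ^ (N+1)" .
      qed
    qed auto
    also have "\<dots> = C * (norm q powr (- Re z) * norm u ^ (N+1))"
      unfolding C_def sum_distrib_right [symmetric] by (simp only: mult_ac)
    also have "norm q powr (- Re z) * norm u ^ (N+1) = norm q powr (- Re z - real N - 1)"
    proof -
      have "norm u ^ (N+1) = norm q powr (- real (N+1))"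
        unfolding u_def norm_divide powr_minus_divide
        by (subst powr_realpow) (use q0 in \<open>auto simp: power_divide\<close>)
      moreover have "- Re z - real N - 1 = - Re z + - real (N+1)" by simp
      ultimately show ?thesis by (simp only: powr_add)
    qed
    finally show "norm (boole_defect N z q) \<le> C * norm q powr (- Re z - real N - 1)" .
  qed
qed

subsection \<open>Analytic continuation\<close>

text \<open>What the summation needs of a sector: no shift q + n meets the cut, |q + n| is
  comparable to |q| + n, and since 2 <= c |q| every shift has modulus at least 2, as
  \<open>boole_defect_bound\<close> requires.\<close>

definition far_sector :: "real \<Rightarrow> complex set" where
  "far_sector c = {q. 2 \<le> c * norm q \<and>
     (\<forall>n. q + of_nat n \<notin> \<real>\<^sub>\<le>\<^sub>0 \<and> c * (norm q + real n) \<le> norm (q + of_nat n))}"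

lemma far_sector_nonzero: "q \<in> far_sector c \<Longrightarrow> q \<noteq> 0"
  by (auto simp: far_sector_def)

text \<open>The defect at q + n is of order (|q| + n)^(-p) with p = Re z + N + 1 > 2. Two of these
  powers give the summable factor 1/(n+1)^2; the other p - 2, combined with |q^z|, give |q|^(1-N),
  which is free of z.\<close>

lemma boole_defect_shift_bound:
  fixes R c :: real and N :: nat
  assumes R: "R \<ge> 0" and c: "0 < c" "c \<le> 1"
  obtains C where "\<And>z q n. norm z \<le> R \<Longrightarrow> Re z > 1 - real N \<Longrightarrow> q \<in> far_sector c \<Longrightarrow>
     norm (q powr z * boole_defect N z (q + of_nat n)) \<le> C * norm q powr (1 - real N) * (1 / real (Suc n) ^ 2)"
proof -
  obtain C0 where C0: "C0 \<ge> 0" "\<And>z q. norm z \<le> R \<Longrightarrow> norm q \<ge> 2 \<Longrightarrow> q \<notin> \<real>\<^sub>\<le>\<^sub>0 \<Longrightarrow>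
     norm (boole_defect N z q) \<le> C0 * norm q powr (- Re z - real N - 1)"
    by (rule boole_defect_bound[OF R, where N = N]) blast
  define C where "C = exp (pi * R) * (C0 * c powr (- (R + real N + 1)))"
  show ?thesis
  proof
    fix z q :: complex and n :: nat
    assume z: "norm z \<le> R" "Re z > 1 - real N" and q: "q \<in> far_sector c"
    define p where "p = Re z + real N + 1"
    define x where "x = norm q + real n"
    have p: "p \<ge> 2" "p \<le> R + real N + 1"
      using z complex_Re_le_cmod[of z] by (auto simp: p_def)
    have q': "2 \<le> c * norm q" "q + of_nat n \<notin> \<real>\<^sub>\<le>\<^sub>0" "c * x \<le> norm (q + of_nat n)"
      using q by (auto simp: far_sector_def x_def)
    have "c * norm q \<le> 1 * norm q" using c by (intro mult_right_mono) auto
    hence nq: "norm q \<ge> 2" using q' by linarith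
    have "c * norm q \<le> c * x" using c by (simp add: x_def)
    hence big: "norm (q + of_nat n) \<ge> 2" using q' by linarith
    have x: "x > 0" "x \<ge> norm q" "x \<ge> 1 + real n" using nq by (auto simp: x_def)
    have "norm (q + of_nat n) powr (- p) \<le> (c * x) powr (- p)"
      using q' x c p by (intro powr_mono2') auto
    also have "\<dots> = c powr (- p) * x powr (- p)"
      using x c by (simp add: powr_mult)
    \<comment> \<open>Since c <= 1 and p <= R + N + 1, this makes the constant independent of
      \<open>z\<close>.\<close>
    also have "\<dots> \<le> c powr (- (R + real N + 1)) * x powr (- p)"
      using p c by (intro mult_right_mono powr_mono') auto
    \<comment> \<open>\<open>x\<close> is at least |q| and at least n + 1, so its powers can be
      shared between the two.\<close>
    also have "x powr (- p) = x powr (- (p - 2)) * x powr (- 2)"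
      by (simp flip: powr_add)
    also have "\<dots> \<le> norm q powr (- (p - 2)) * real (Suc n) powr (- 2)"
      using x nq p by (intro mult_mono powr_mono2') auto
    finally have *: "norm (q + of_nat n) powr (- p) \<le> 
        c powr (- (R + real N + 1)) * (norm q powr (- (p - 2)) * real (Suc n) powr (- 2))"
      by (simp add: mult_left_mono)
    have "norm (boole_defect N z (q + of_nat n)) \<le> C0 * norm (q + of_nat n) powr (- p)"
      using C0(2)[OF z(1) big q'(2)] by (simp add: p_def diff_diff_eq2 diff_diff_add)
    also have "\<dots> \<le> C0 * (c powr (- (R + real N + 1)) * (norm q powr (- (p - 2)) * real (Suc n) powr (- 2)))"
      using * C0 by (intro mult_left_mono) auto
    finally have 1: "norm (boole_defect N z (q + of_nat n)) \<le> 
       C0 * (c powr (- (R + real N + 1)) * (norm q powr (- (p - 2)) * real (Suc n) powr (- 2)))" .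
    have 2: "norm (q powr z) \<le> norm q powr Re z * exp (pi * R)"
      by (rule order_trans[OF norm_powr_le]) (use z in \<open>auto intro!: mult_left_mono\<close>)
    have "norm (q powr z * boole_defect N z (q + of_nat n)) \<le> (norm q powr Re z * exp (pi * R)) *
       (C0 * (c powr (- (R + real N + 1)) * (norm q powr (- (p - 2)) * real (Suc n) powr (- 2))))"
      unfolding norm_mult by (intro mult_mono 1 2) auto
    also have "\<dots> = C * (norm q powr Re z * norm q powr (- (p - 2))) * real (Suc n) powr (- 2)"
      by (simp add: C_def mult_ac)
    also have "norm q powr Re z * norm q powr (- (p - 2)) = norm q powr (1 - real N)"
      by (simp add: p_def flip: powr_add)
    also have "real (Suc n) powr (- 2) = 1 / real (Suc n) ^ 2"
      by (subst powr_minus_divide, subst powr_numeral) auto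
    finally show "norm (q powr z * boole_defect N z (q + of_nat n)) \<le> 
        C * norm q powr (1 - real N) * (1 / real (Suc n) ^ 2)" .
  qed
qed

section \<open>Summation of the defects\<close>

lemma summable_inverse_Suc_squares: "summable (\<lambda>n. 1 / real (Suc n) ^ 2)"
  using inverse_power_summable[of 2, where ?'a = real]
  by (subst summable_Suc_iff) (simp add: inverse_eq_divide)

definition boole_series :: "nat \<Rightarrow> complex \<Rightarrow> complex \<Rightarrow> complex" where
  "boole_series N z q = (\<Sum>n. (-1) ^ n * boole_defect N z (q + of_nat n))"

lemma summable_boole_defect:
  assumes c: "0 < c" "c \<le> 1" and q: "q \<in> far_sector c" and z: "Re z > 1 - real N"
  shows "summable (\<lambda>n. (-1) ^ n * boole_defect N z (q + of_nat n))"
proof -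
  obtain C where "\<And>w q n. norm w \<le> norm z \<Longrightarrow> Re w > 1 - real N \<Longrightarrow> q \<in> far_sector c \<Longrightarrow>
     norm (q powr w * boole_defect N w (q + of_nat n)) \<le> C * norm q powr (1 - real N) * (1 / real (Suc n) ^ 2)"
    by (rule boole_defect_shift_bound[OF norm_ge_zero c, where N = N]) blast
  from this[OF order_refl z q] have "summable (\<lambda>n. q powr z * ((-1) ^ n * boole_defect N z (q + of_nat n)))"
    by (intro summable_comparison_test'[OF summable_mult[OF summable_inverse_Suc_squares]])
       (auto simp: norm_mult norm_power)
  thus ?thesis
    by (rule summable_mult_D) (use far_sector_nonzero[OF q] in auto)
qed

lemma boole_series_bound:
  fixes R c :: real and N :: nat
  assumes R: "R \<ge> 0" and c: "0 < c" "c \<le> 1"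
  obtains C where "\<And>z q. norm z \<le> R \<Longrightarrow> Re z > 1 - real N \<Longrightarrow> q \<in> far_sector c \<Longrightarrow>
     norm (q powr z * boole_series N z q) \<le> C * norm q powr (1 - real N)"
proof -
  obtain C where C: "\<And>z q n. norm z \<le> R \<Longrightarrow> Re z > 1 - real N \<Longrightarrow> q \<in> far_sector c \<Longrightarrow>
     norm (q powr z * boole_defect N z (q + of_nat n)) \<le> C * norm q powr (1 - real N) * (1 / real (Suc n) ^ 2)"
    by (rule boole_defect_shift_bound[OF R c, where N = N]) blast
  show ?thesis
  proof
    fix z q assume z: "norm z \<le> R" "Re z > 1 - real N" and q: "q \<in> far_sector c"
    have "q powr z * boole_series N z q = (\<Sum>n. q powr z * ((-1) ^ n * boole_defect N z (q + of_nat n)))"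
      unfolding boole_series_def by (rule suminf_mult [symmetric]) (rule summable_boole_defect[OF c q z(2)])
    also have "norm \<dots> \<le> (\<Sum>n. C * norm q powr (1 - real N) * (1 / real (Suc n) ^ 2))"
      by (intro norm_suminf_le summable_mult summable_inverse_Suc_squares)
         (use C[OF z q] in \<open>auto simp: norm_mult norm_power\<close>)
    also have "\<dots> = C * norm q powr (1 - real N) * (\<Sum>n. 1 / real (Suc n) ^ 2)"
      by (rule suminf_mult[OF summable_inverse_Suc_squares])
    finally show "norm (q powr z * boole_series N z q) \<le> 
      (C * (\<Sum>n. 1 / real (Suc n) ^ 2)) * norm q powr (1 - real N)" by (simp only: mult_ac)
  qed
qed

lemma holomorphic_boole_sum [holomorphic_intros]: "(\<lambda>z. boole_sum N z q) holomorphic_on A"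
  unfolding boole_sum_def by (intro holomorphic_intros)

lemma holomorphic_boole_defect [holomorphic_intros]: "(\<lambda>z. boole_defect N z q) holomorphic_on A"
  unfolding boole_defect_def by (intro holomorphic_intros)

text \<open>Weierstrass M-test: multiplied by q^z, the terms have a majorant independent of z as
  long as z is bounded. Hence the half-plane is exhausted by the bounded sets
  \<open>A R\<close>.\<close>

lemma holomorphic_boole_series:
  assumes c: "0 < c" "c \<le> 1" and q: "q \<in> far_sector c"
  shows "(\<lambda>z. boole_series N z q) holomorphic_on {z. Re z > 1 - real N}"
proof -
  define A where "A R = ball 0 (real R) \<inter> {z. Re z > 1 - real N}" for R
  have "(\<lambda>z. q powr z * boole_series N z q) holomorphic_on A R" for R
  proof (rule holomorphic_uniform_sequence)
    show "open (A R)" unfolding A_def by (intro open_Int open_ball open_halfspace_Re_gt)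
    thus "\<exists>d. 0 < d \<and> cball x d \<subseteq> A R \<and> uniform_limit (cball x d)
       (\<lambda>M z. \<Sum>n<M. q powr z * ((-1) ^ n * boole_defect N z (q + of_nat n))) (\<lambda>z. q powr z * boole_series N z q) sequentially"
      if "x \<in> A R" for x
    proof -
      obtain d where d: "d > 0" "cball x d \<subseteq> A R"
        using \<open>open (A R)\<close> \<open>x \<in> A R\<close> open_contains_cball by blast
      obtain C where C: "\<And>z q n. norm z \<le> real R \<Longrightarrow> Re z > 1 - real N \<Longrightarrow> q \<in> far_sector c \<Longrightarrow>
         norm (q powr z * boole_defect N z (q + of_nat n)) \<le> C * norm q powr (1 - real N) * (1 / real (Suc n) ^ 2)"
        by (rule boole_defect_shift_bound[OF of_nat_0_le_iff c, where N = N]) blast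
      have "uniform_limit (A R) (\<lambda>M z. \<Sum>n<M. q powr z * ((-1) ^ n * boole_defect N z (q + of_nat n)))
              (\<lambda>z. \<Sum>n. q powr z * ((-1) ^ n * boole_defect N z (q + of_nat n))) sequentially"
      proof (rule Weierstrass_m_test)
        show "summable (\<lambda>n. C * norm q powr (1 - real N) * (1 / real (Suc n) ^ 2))"
          by (intro summable_mult summable_inverse_Suc_squares)
        show "norm (q powr z * ((-1) ^ n * boole_defect N z (q + of_nat n))) \<le>
            C * norm q powr (1 - real N) * (1 / real (Suc n) ^ 2)" if "z \<in> A R" for n z
          using C[of z q n] that q by (simp add: norm_mult norm_power A_def)
      qed
      also have "?this \<longleftrightarrow> uniform_limit (A R) (\<lambda>M z. \<Sum>n<M. q powr z * ((-1) ^ n * boole_defect N z (q + of_nat n)))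
              (\<lambda>z. q powr z * boole_series N z q) sequentially"
        unfolding boole_series_def
        by (intro uniform_limit_cong' suminf_mult summable_boole_defect[OF c q]) (auto simp: A_def)
      finally show ?thesis using d by (blast intro: uniform_limit_on_subset)
    qed
  qed (intro holomorphic_intros)
  hence "(\<lambda>z. q powr (- z) * (q powr z * boole_series N z q)) holomorphic_on A R" for R
    by (rule holomorphic_on_mult[rotated]) (intro holomorphic_intros)
  also have "(\<lambda>z. q powr (- z) * (q powr z * boole_series N z q)) = (\<lambda>z. boole_series N z q)"
    using far_sector_nonzero[OF q] by (simp add: powr_minus field_simps)
  finally have "(\<lambda>z. boole_series N z q) holomorphic_on (\<Union>R. A R)"
    by (intro holomorphic_on_UN_open) (auto simp: A_def open_halfspace_Re_gt open_Int)
  also have "(\<Union>R. A R) = {z. Re z > 1 - real N}"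
    by (auto simp: A_def intro: reals_Archimedean2)
  finally show ?thesis .
qed

section \<open>Telescoping and identification with the alternating series\<close>

text \<open>Because of the alternating signs, the values of \<open>boole_sum\<close> cancel between
  neighbouring defects, and only those at the two ends remain.\<close>

lemma boole_defect_partial_sum:
  "(\<Sum>n<M. (-1) ^ n * boole_defect N z (q + of_nat n)) + boole_sum N z q =
   (\<Sum>n<M. (-1) ^ n / (q + of_nat n) powr z) + (-1) ^ M * boole_sum N z (q + of_nat M)"
proof (induction M)
  case (Suc M)
  have *: "(q + of_nat M) + 1 = q + of_nat (Suc M)" by simp
  have defect: "(-1) ^ M * boole_defect N z (q + of_nat M) =
     (-1) ^ M / (q + of_nat M) powr z - (-1) ^ M * boole_sum N z (q + of_nat M) + (-1) ^ Suc M * boole_sum N z (q + of_nat (Suc M))"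
    unfolding boole_defect_def * by (simp add: powr_minus field_simps del: of_nat_Suc)
  have "boole_sum N z q = (\<Sum>n<M. (-1) ^ n / (q + of_nat n) powr z) + (-1) ^ M * boole_sum N z (q + of_nat M)
     - (\<Sum>n<M. (-1) ^ n * boole_defect N z (q + of_nat n))"
    using Suc by (simp add: eq_diff_eq add.commute)
  thus ?case unfolding sum.lessThan_Suc defect by simp
qed simp

lemma powr_shift_tendsto_0:
  fixes q w :: complex
  assumes "Re w < 0"
  shows "(\<lambda>M. (q + of_nat M) powr w) \<longlonglongrightarrow> 0"
proof (rule Lim_null_comparison)
  show "\<forall>\<^sub>F M in sequentially. norm ((q + of_nat M) powr w) \<le> norm (q + of_nat M) powr Re w * exp (pi * norm w)"
    using norm_powr_le by (intro always_eventually) auto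
  have "filterlim (\<lambda>M. - norm q + real M) at_top sequentially"
    by (intro filterlim_tendsto_add_at_top[OF tendsto_const] filterlim_real_sequentially)
  hence "filterlim (\<lambda>M. norm (q + of_nat M)) at_top sequentially"
  proof (rule filterlim_at_top_mono)
    have "- norm q + real M \<le> norm (q + of_nat M)" for M
      using norm_diff_ineq[of "of_nat M" q] by (simp add: add.commute)
    thus "\<forall>\<^sub>F M in sequentially. - norm q + real M \<le> norm (q + of_nat M)"
      by simp
  qed
  hence "(\<lambda>M. norm (q + of_nat M) powr Re w) \<longlonglongrightarrow> 0"
    using assms by (intro tendsto_neg_powr)
  thus "(\<lambda>M. norm (q + of_nat M) powr Re w * exp (pi * norm w)) \<longlonglongrightarrow> 0"
    by (rule tendsto_mult_left_zero)
qed

text \<open>The index set is kept general: it is \<open>{..N}\<close> when the series is identified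
  and \<open>{N<..N'}\<close> when two orders are compared.\<close>

lemma boole_terms_tendsto_0:
  assumes "\<And>n. n \<in> A \<Longrightarrow> Re z + real n > 0"
  shows "(\<lambda>M. (-1) ^ M * (1/2 * (\<Sum>n\<in>A. boole_coeff n * pochhammer z n * (q + of_nat M) powr (- z - of_nat n)))) \<longlonglongrightarrow> 0"
proof -
  have "(\<lambda>M. 1/2 * (\<Sum>n\<in>A. boole_coeff n * pochhammer z n * (q + of_nat M) powr (- z - of_nat n))) \<longlonglongrightarrow> 0"
    by (intro tendsto_mult_right_zero tendsto_null_sum powr_shift_tendsto_0)
       (use assms in \<open>force\<close>)
  thus ?thesis
    by (subst tendsto_norm_zero_iff [symmetric], subst (asm) tendsto_norm_zero_iff [symmetric])
       (simp add: norm_mult norm_power)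
qed

definition boole_cont :: "nat \<Rightarrow> complex \<Rightarrow> complex \<Rightarrow> complex" where
  "boole_cont N z q = boole_sum N z q + boole_series N z q"

lemma holomorphic_boole_cont:
  assumes "0 < c" "c \<le> 1" "q \<in> far_sector c"
  shows "(\<lambda>z. boole_cont N z q) holomorphic_on {z. Re z > 1 - real N}"
  unfolding boole_cont_def by (intro holomorphic_intros holomorphic_boole_series[OF assms])

lemma boole_cont_LIMSEQ:
  assumes "0 < c" "c \<le> 1" "q \<in> far_sector c" "Re z > 1 - real N"
  shows "(\<lambda>M. (\<Sum>n<M. (-1) ^ n / (q + of_nat n) powr z) + (-1) ^ M * boole_sum N z (q + of_nat M)) \<longlonglongrightarrow> boole_cont N z q"
proof -
  have "(\<lambda>M. (\<Sum>n<M. (-1) ^ n * boole_defect N z (q + of_nat n)) + boole_sum N z q) \<longlonglongrightarrow> boole_series N z q + boole_sum N z q"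
    unfolding boole_series_def
    by (intro tendsto_intros summable_LIMSEQ summable_boole_defect[OF assms])
  thus ?thesis
    unfolding boole_defect_partial_sum boole_cont_def by (simp add: add.commute)
qed

text \<open>Independence of the order: both sides are limits of the alternating partial sums plus an
  end term. The end terms differ by multiples of (q+M)^(-z-n) with n > N, which tend to 0 because Re
  z + n > 0.\<close>

lemma boole_cont_mono:
  assumes "0 < c" "c \<le> 1" "q \<in> far_sector c" "Re z > 1 - real N" "N \<le> N'"
  shows "boole_cont N' z q = boole_cont N z q"
proof -
  have split: "boole_sum N' z x = boole_sum N z x + 
     1/2 * (\<Sum>n\<in>{N<..N'}. boole_coeff n * pochhammer z n * x powr (- z - of_nat n))" for x
  proof -
    have "{..N'} = {..N} \<union> {N<..N'}" using assms(5) by auto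
    thus ?thesis unfolding boole_sum_def by (simp add: sum.union_disjoint distrib_left Int_def)
  qed
  have "(\<lambda>M. ((\<Sum>n<M. (-1) ^ n / (q + of_nat n) powr z) + (-1) ^ M * boole_sum N z (q + of_nat M)) +
     (-1) ^ M * (1/2 * (\<Sum>n\<in>{N<..N'}. boole_coeff n * pochhammer z n * (q + of_nat M) powr (- z - of_nat n))))
     \<longlonglongrightarrow> boole_cont N z q + 0"
    by (intro tendsto_add boole_cont_LIMSEQ[OF assms(1-4)] boole_terms_tendsto_0) (use assms(4) in auto)
  hence "(\<lambda>M. (\<Sum>n<M. (-1) ^ n / (q + of_nat n) powr z) + (-1) ^ M * boole_sum N' z (q + of_nat M)) \<longlonglongrightarrow> boole_cont N z q"
    by (simp add: split algebra_simps)
  moreover have "(\<lambda>M. (\<Sum>n<M. (-1) ^ n / (q + of_nat n) powr z) + (-1) ^ M * boole_sum N' z (q + of_nat M)) \<longlonglongrightarrow> boole_cont N' z q"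
    by (rule boole_cont_LIMSEQ[OF assms(1-3)]) (use assms(4,5) in auto)
  ultimately show ?thesis
    using LIMSEQ_unique by blast
qed

text \<open>For Re z > 0 the whole end term tends to 0, so the plain partial sums converge, in their
  given order.\<close>

lemma boole_cont_sums:
  assumes "0 < c" "c \<le> 1" "q \<in> far_sector c" "Re z > 1 - real N" "Re z > 0"
  shows "(\<lambda>n. (-1) ^ n / (of_nat n + q) powr z) sums boole_cont N z q"
proof -
  have "(\<lambda>M. (-1) ^ M * boole_sum N z (q + of_nat M)) \<longlonglongrightarrow> 0"
    unfolding boole_sum_def by (rule boole_terms_tendsto_0) (use assms(5) in auto)
  from tendsto_diff[OF boole_cont_LIMSEQ[OF assms(1-4)] this] show ?thesis
    by (simp add: sums_def add.commute)
qed

text \<open>By \<open>boole_cont_mono\<close> the functions of different orders glue to an entire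
  function with the defining property. The identity theorem makes it the only one, which resolves
  the definite description.\<close>

lemma zeta_E_eq_boole_cont:
  assumes c: "0 < c" "c \<le> 1" and q: "q \<in> far_sector c" and z: "Re z > 1 - real N"
  shows "zeta_E z q = boole_cont N z q"
proof -
  \<comment> \<open>The index is at least 2 - Re z, which puts z inside the half-plane Re z > 1 -
    N.\<close>
  define f where "f z = boole_cont (nat \<lceil>2 - Re z\<rceil>) z q" for z
  have f_eq: "f z = boole_cont N z q" if "Re z > 1 - real N" for z N
  proof -
    have "Re z > 1 - real (nat \<lceil>2 - Re z\<rceil>)"
      by linarith
    thus ?thesis
      unfolding f_def using boole_cont_mono[OF c q] that by (metis nle_le)
  qed
  have f_hol: "f holomorphic_on UNIV"
  proof -
    have "f holomorphic_on (\<Union>N. {z. Re z > 1 - real N})"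
    proof (intro holomorphic_on_UN_open open_halfspace_Re_gt)
      fix N
      show "f holomorphic_on {z. Re z > 1 - real N}"
        by (rule holomorphic_transform[OF holomorphic_boole_cont[OF c q]]) (use f_eq in auto)
    qed
    also have "(\<Union>N. {z. Re z > 1 - real N}) = UNIV"
    proof -
      have "\<exists>N. Re z > 1 - real N" for z
        using reals_Archimedean2[of "1 - Re z"] by (auto simp: algebra_simps)
      thus ?thesis by auto
    qed
    finally show ?thesis .
  qed
  \<comment> \<open>Order 1 is used, whose half-plane is exactly Re z > 0.\<close>
  have f_sums: "(\<lambda>n. (-1) ^ n / (of_nat n + q) powr z) sums f z" if "Re z > 0" for z
    using boole_cont_sums[OF c q _ that, of 1] f_eq[of 1 z] that by simp
  have "(THE f. f holomorphic_on UNIV \<and>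
     (\<forall>z. Re z > 0 \<longrightarrow> (\<lambda>n. (-1) ^ n / (of_nat n + q) powr z) sums f z)) = f"
  proof (rule the_equality)
    fix g assume g: "g holomorphic_on UNIV \<and>
       (\<forall>z. Re z > 0 \<longrightarrow> (\<lambda>n. (-1) ^ n / (of_nat n + q) powr z) sums g z)"
    show "g = f"
    proof
      fix z
      show "g z = f z"
      proof (rule analytic_continuation_open[of "{z. Re z > 0}" UNIV g f z])
        show "open {z. Re z > 0}" by (rule open_halfspace_Re_gt)
        show "{z. Re z > 0} \<noteq> {}" by (auto intro: exI[of _ 1])
        show "g w = f w" if "w \<in> {z. Re z > 0}" for w
          using g f_sums[of w] that sums_unique2 by auto
      qed (use g f_hol in auto)
    qed
  qed (use f_hol f_sums in auto)
  thus ?thesis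
    unfolding zeta_E_def using f_eq[OF z] by simp
qed

subsection \<open>Asymptotic expansion\<close>

text \<open>Here c = sin(\<delta>/2). In the sector |q+n|^2 >= |q|^2 - 2n|q| cos \<delta> + n^2, and
  the right side is c^2 (|q|+n)^2 + cos^2(\<delta>/2) (|q|-n)^2.\<close>

lemma sector_subset_far_sector:
  fixes \<delta> :: real
  assumes "\<delta> > 0"
  obtains c where "0 < c" "c \<le> 1"
    "\<And>q. \<bar>Arg q\<bar> \<le> pi - \<delta> \<Longrightarrow> norm q \<ge> 2 / c \<Longrightarrow> q \<in> far_sector c"
proof (cases "\<delta> \<le> pi")
  \<comment> \<open>For \<delta> > pi the sector is empty.\<close>
  case False
  have "q \<in> far_sector 1" if "\<bar>Arg q\<bar> \<le> pi - \<delta>" for q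
    using that False by linarith
  thus ?thesis by (intro that[of 1]) auto
next
  case True
  have "cos \<delta> < cos 0"
    using assms True by (intro cos_monotone_0_pi) auto
  define c where "c = sqrt ((1 - cos \<delta>) / 2)"
  have c2: "c ^ 2 = (1 - cos \<delta>) / 2" and c: "c > 0"
    using \<open>cos \<delta> < cos 0\<close> by (auto simp: c_def)
  have "c ^ 2 \<le> 1 ^ 2"
    unfolding c2 using cos_ge_minus_one[of \<delta>] by simp
  hence c1: "c \<le> 1" by (rule power2_le_imp_le) simp
  show ?thesis
  proof (rule that[OF c c1])
    fix q :: complex
    assume q: "\<bar>Arg q\<bar> \<le> pi - \<delta>" "norm q \<ge> 2 / c"
    have big: "2 \<le> c * norm q" using q(2) c by (simp add: field_simps)
    hence q0: "q \<noteq> 0" by auto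
    have "cos (pi - \<delta>) \<le> cos \<bar>Arg q\<bar>"
      using q assms by (intro cos_monotone_0_pi_le) auto
    hence "norm q * (- cos \<delta>) \<le> norm q * cos (Arg q)"
      by (intro mult_left_mono) auto
    also have "norm q * cos (Arg q) = Re q"
      by (metis Re_rcis rcis_cmod_Arg)
    finally have Re_q: "- norm q * cos \<delta> \<le> Re q" by simp
    have "c * (norm q + real n) \<le> norm (q + of_nat n)" for n
    proof (rule power2_le_imp_le)
      have "(c * (norm q + real n))\<^sup>2 + (1 + cos \<delta>) / 2 * (norm q - real n)\<^sup>2 = 
              (norm q)\<^sup>2 + 2 * real n * (- norm q * cos \<delta>) + (real n)\<^sup>2"
        unfolding power_mult_distrib c2 by (simp add: power2_eq_square field_simps)
      also have "\<dots> \<le> (norm q)\<^sup>2 + 2 * real n * Re q + (real n)\<^sup>2"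
        using Re_q by (intro add_mono mult_left_mono) auto
      also have "\<dots> = (norm (q + of_nat n))\<^sup>2"
        unfolding cmod_power2 by (simp add: power2_eq_square algebra_simps)
      finally have "(c * (norm q + real n))\<^sup>2 + (1 + cos \<delta>) / 2 * (norm q - real n)\<^sup>2 \<le> (norm (q + of_nat n))\<^sup>2" .
      moreover have "(1 + cos \<delta>) / 2 * (norm q - real n)\<^sup>2 \<ge> 0"
        using cos_ge_minus_one[of \<delta>] by (intro mult_nonneg_nonneg divide_nonneg_pos zero_le_power2) linarith+
      ultimately show "(c * (norm q + real n))\<^sup>2 \<le> (norm (q + of_nat n))\<^sup>2"
        by linarith
    qed auto
    \<comment> \<open>Otherwise q itself would lie on the negative real axis, where
      \<open>Arg\<close> is pi, outside the sector.\<close>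
    moreover have "q + of_nat n \<notin> \<real>\<^sub>\<le>\<^sub>0" for n
    proof
      assume "q + of_nat n \<in> \<real>\<^sub>\<le>\<^sub>0"
      hence "Re q \<le> 0" "Im q = 0" by (auto simp: complex_nonpos_Reals_iff)
      with q0 have "Arg q = pi" by (auto simp: Arg_eq_pi complex_eq_iff)
      with q assms show False by simp
    qed
    ultimately show "q \<in> far_sector c" using big by (auto simp: far_sector_def)
  qed
qed

lemma holomorphic_zeta_E:
  assumes c: "0 < c" "c \<le> 1" and q: "q \<in> far_sector c"
  shows "(\<lambda>z. zeta_E z q) holomorphic_on {z. Re z > 1 - real N}"
  by (rule holomorphic_transform[OF holomorphic_boole_cont[OF c q]])
     (use zeta_E_eq_boole_cont[OF c q] in auto)

lemma powr_mult_boole_sum: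
  assumes "q \<noteq> 0"
  shows "q powr z * boole_sum N z q = 1/2 * (\<Sum>n\<le>N. boole_coeff n * pochhammer z n * (1 / q) ^ n)"
proof -
  have "q powr z * boole_sum N z q = 
    (q powr z * q powr (- z)) * (1/2 * (\<Sum>n\<le>N. boole_coeff n * pochhammer z n * (1 / q) ^ n))"
    unfolding boole_sum_def powr_minus_of_nat[OF assms] by (simp add: sum_distrib_left mult_ac)
  also have "q powr z * q powr (- z) = 1"
    using assms by (simp add: powr_minus)
  finally show ?thesis by simp
qed

text \<open>\<open>zeta_E\<close> is represented at a larger order \<open>N\<close>; the terms with
  m < n <= N and the series of defects are all O(|q|^(-m-1)), uniformly for |z| <= R.\<close>

lemma zeta_E_expansion_bound:
  fixes R c :: real and m :: nat
  assumes R: "R \<ge> 0" and c: "0 < c" "c \<le> 1"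
  obtains D where "\<And>z q. norm z \<le> R \<Longrightarrow> q \<in> far_sector c \<Longrightarrow>
     norm (q powr z * zeta_E z q - 1/2 * (\<Sum>n\<le>m. boole_coeff n * pochhammer z n * (1 / q) ^ n)) \<le>
       D * norm q powr (- real (Suc m))"
proof -
  \<comment> \<open>This gives 1 - N < -R, so the disc |z| <= R lies in the half-plane, and 1 - N <=
    -(m+1), the order wanted.\<close>
  define N where "N = m + 2 + nat \<lceil>R\<rceil>"
  obtain C where C: "\<And>z q. norm z \<le> R \<Longrightarrow> Re z > 1 - real N \<Longrightarrow> q \<in> far_sector c \<Longrightarrow>
     norm (q powr z * boole_series N z q) \<le> C * norm q powr (1 - real N)"
    by (rule boole_series_bound[OF R c, where N = N]) blast
  define D where "D = 1/2 * (\<Sum>n\<in>{m<..N}. norm (boole_coeff n) * pochhammer R n) + \<bar>C\<bar>"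
  show ?thesis
  proof
    fix z q :: complex
    assume z: "norm z \<le> R" and q: "q \<in> far_sector c"
    have q0: "q \<noteq> 0" using far_sector_nonzero[OF q] .
    have "2 \<le> c * norm q" using q by (simp add: far_sector_def)
    also have "c * norm q \<le> 1 * norm q" using c by (intro mult_right_mono) auto
    finally have nq: "norm q \<ge> 1" by simp
    have Re_z: "Re z > 1 - real N"
      using abs_Re_le_cmod[of z] z unfolding N_def by linarith
    define t where "t n = boole_coeff n * pochhammer z n * (1 / q) ^ n" for n
    have "q powr z * zeta_E z q = 1/2 * (\<Sum>n\<le>N. t n) + q powr z * boole_series N z q"
      unfolding zeta_E_eq_boole_cont[OF c q Re_z] boole_cont_def distrib_left powr_mult_boole_sum[OF q0] t_def ..
    also have "{..N} = {..m} \<union> {m<..N}" by (auto simp: N_def)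
    also have "(\<Sum>n\<in>\<dots>. t n) = (\<Sum>n\<le>m. t n) + (\<Sum>n\<in>{m<..N}. t n)"
      by (rule sum.union_disjoint) auto
    finally have "q powr z * zeta_E z q - 1/2 * (\<Sum>n\<le>m. t n) = 
      1/2 * (\<Sum>n\<in>{m<..N}. t n) + q powr z * boole_series N z q"
      by (simp add: algebra_simps)
    also have "norm \<dots> \<le> norm (1/2 * (\<Sum>n\<in>{m<..N}. t n)) + norm (q powr z * boole_series N z q)"
      by (rule norm_triangle_ineq)
    also have "norm (1/2 * (\<Sum>n\<in>{m<..N}. t n)) = 1/2 * norm (\<Sum>n\<in>{m<..N}. t n)"
      by (simp add: norm_mult norm_divide)
    also have "\<dots> \<le> 1/2 * (\<Sum>n\<in>{m<..N}. norm (boole_coeff n) * pochhammer R n * norm q powr (- real (Suc m)))"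
    proof (intro mult_left_mono sum_norm_le)
      fix n assume n: "n \<in> {m<..N}"
      have "norm ((1 / q) ^ n) = norm q powr (- real n)"
        unfolding powr_minus_divide norm_power norm_divide
        by (subst powr_realpow) (use q0 in \<open>auto simp: power_one_over\<close>)
      also have "\<dots> \<le> norm q powr (- real (Suc m))"
        using n nq by (intro powr_mono) auto
      finally show "norm (t n) \<le> norm (boole_coeff n) * pochhammer R n * norm q powr (- real (Suc m))"
        unfolding t_def norm_mult using z R
        by (intro mult_mono norm_pochhammer_le mult_nonneg_nonneg pochhammer_nonneg_real) auto
    qed auto
    also have "norm (q powr z * boole_series N z q) \<le> C * norm q powr (1 - real N)"
      by (rule C[OF z Re_z q])
    also have "\<dots> \<le> \<bar>C\<bar> * norm q powr (- real (Suc m))"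
      using nq by (intro mult_mono powr_mono) (auto simp: N_def)
    finally show "norm (q powr z * zeta_E z q - 1/2 * (\<Sum>n\<le>m. boole_coeff n * pochhammer z n * (1 / q) ^ n)) \<le>
       D * norm q powr (- real (Suc m))"
      unfolding D_def t_def [symmetric] by (simp add: sum_distrib_right distrib_right sum_divide_distrib)
  qed
qed

text \<open>Fits the truncation: with 2K+2 as upper index the first neglected order is 2K+3, and the
  last term, of even index, is zero.\<close>

lemma sum_vanishing_even:
  fixes f :: "nat \<Rightarrow> 'a :: comm_monoid_add"
  assumes "\<And>n. even n \<Longrightarrow> f n = 0"
  shows "(\<Sum>n\<le>2*K+2. f n) = f 1 + (\<Sum>k=1..K. f (2*k+1))"
proof (induction K)
  case 0
  thus ?case using assms[of 0] assms[of 2] by (simp add: numeral_2_eq_2)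
next
  case (Suc K)
  have "2 * Suc K + 2 = Suc (Suc (2*K+2))" by simp
  moreover have "f (Suc (Suc (2*K+2))) = 0" by (intro assms) auto
  ultimately have "(\<Sum>n\<le>2 * Suc K + 2. f n) = (\<Sum>n\<le>2*K+2. f n) + f (Suc (2*K+2))"
    by (simp only: sum.atMost_Suc add_0_right)
  also have "Suc (2*K+2) = 2 * Suc K + 1" by simp
  finally show ?case unfolding Suc by (simp add: add.assoc)
qed

text \<open>The filter describes |q| tending to infinity within the sector. \<open>K\<close> is the
  truncation index; the constant is chosen after \<open>s\<close>, \<open>\<delta>\<close> and
  \<open>K\<close>.\<close>

theorem theorem3p9:
  fixes s :: complex and \<delta> :: real and K :: nat
  assumes "\<delta> > 0"
  shows "(\<lambda>q. deriv (\<lambda>z. zeta_E z q) s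
            - (1/4 * q powr (-s - 1) - zeta_E s q * Ln q
               - 1/2 * (\<Sum>k=1..K. euler_poly (2*k+1) 0
                   * (\<Sum>j=0..2*k. pochhammer s j / (fact j * of_nat (2*k - j + 1)))
                   * q powr (-s - of_nat (2*k) - 1))))
         \<in> O[inf at_infinity (principal {q. \<bar>Arg q\<bar> \<le> pi - \<delta>})](
             \<lambda>q. of_real (norm q powr (-Re s - 2 * real K - 3)))"
    (is "?E \<in> _")
proof -
  obtain c where c: "0 < c" "c \<le> 1"
    and far: "\<And>q. \<bar>Arg q\<bar> \<le> pi - \<delta> \<Longrightarrow> norm q \<ge> 2 / c \<Longrightarrow> q \<in> far_sector c"
    by (rule sector_subset_far_sector[OF assms]) blast
  \<comment> \<open>Makes the closed unit disc about \<open>s\<close> lie in |z| <= R, ready for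
    Cauchy's inequality with radius 1.\<close>
  define R where "R = norm s + 1"
  \<comment> \<open>The remainder then has order m + 1 = 2K + 3.\<close>
  define m where "m = 2 * K + 2"
  have "R \<ge> 0" by (simp add: R_def)
  obtain D where D: "\<And>z q. norm z \<le> R \<Longrightarrow> q \<in> far_sector c \<Longrightarrow>
     norm (q powr z * zeta_E z q - 1/2 * (\<Sum>n\<le>m. boole_coeff n * pochhammer z n * (1 / q) ^ n)) \<le>
       D * norm q powr (- real (Suc m))"
    by (rule zeta_E_expansion_bound[OF \<open>R \<ge> 0\<close> c, where m = m]) blast
  have main: "norm (?E q) \<le> exp (pi * norm s) * D * norm q powr (-Re s - 2 * real K - 3)"
    if q: "q \<in> far_sector c" for q
  proof -
    have q0: "q \<noteq> 0" using far_sector_nonzero[OF q] .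
    define P where "P z = q powr z * zeta_E z q - 1/2 * (\<Sum>n\<le>m. boole_coeff n * pochhammer z n * (1 / q) ^ n)" for z
    define N where "N = 2 + nat \<lceil>R\<rceil>"
    define H where "H = {z. Re z > 1 - real N}"
    have "open H" unfolding H_def by (rule open_halfspace_Re_gt)
    have zeta_hol: "(\<lambda>z. zeta_E z q) holomorphic_on H"
      unfolding H_def by (rule holomorphic_zeta_E[OF c q])
    have P_hol: "P holomorphic_on H"
      unfolding P_def by (intro holomorphic_intros zeta_hol)
    have norm_le_R: "norm z \<le> R" if "z \<in> cball s 1" for z
      using that norm_triangle_ineq2[of z s] by (simp add: R_def dist_norm norm_minus_commute)
    have sub: "cball s 1 \<subseteq> H"
    proof
      fix z assume "z \<in> cball s 1"
      thus "z \<in> H" using norm_le_R[of z] abs_Re_le_cmod[of z] unfolding H_def N_def mem_Collect_eq by linarith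
    qed
    \<comment> \<open>On a circle of radius 1 Cauchy's inequality carries the uniform bound for
      \<open>P\<close> over to its derivative with the same constant.\<close>
    have "norm ((deriv ^^ 1) P s) \<le> fact 1 * (D * norm q powr (- real (Suc m))) / 1 ^ 1"
    proof (rule Cauchy_inequality)
      show "P holomorphic_on ball s 1"
        using P_hol sub ball_subset_cball by (metis holomorphic_on_subset subset_trans)
      show "continuous_on (cball s 1) P"
        using P_hol sub by (metis holomorphic_on_imp_continuous_on holomorphic_on_subset)
      show "norm (P z) \<le> D * norm q powr (- real (Suc m))" if "norm (s - z) = 1" for z
        unfolding P_def by (intro D norm_le_R q) (use that in \<open>auto simp: dist_norm\<close>)
    qed auto
    hence deriv_P_bound: "norm (deriv P s) \<le> D * norm q powr (- real (Suc m))" by simp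

    define T where "T n = boole_coeff n * (fact n * (\<Sum>j<n. pochhammer s j / (fact j * of_nat (n - j)))) * (1 / q) ^ n" for n
    have "s \<in> H" using sub by auto
    hence zeta': "((\<lambda>z. zeta_E z q) has_field_derivative deriv (\<lambda>z. zeta_E z q) s) (at s)"
      using zeta_hol \<open>open H\<close> by (rule_tac holomorphic_derivI)
    \<comment> \<open>Differentiating q^z produces the logarithmic term, and differentiating the
      rising factorials produces the inner sums.\<close>
    have "(P has_field_derivative 
       (q powr s * deriv (\<lambda>z. zeta_E z q) s + Ln q * q powr s * zeta_E s q) - 1/2 * (\<Sum>n\<le>m. T n)) (at s)"
      unfolding P_def T_def using q0
      by (intro DERIV_diff DERIV_mult' DERIV_cmult DERIV_sum DERIV_cmult_right pochhammer_has_field_derivative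
           zeta' has_field_derivative_powr_right)
    hence deriv_P: "deriv P s = q powr s * deriv (\<lambda>z. zeta_E z q) s + Ln q * q powr s * zeta_E s q - 1/2 * (\<Sum>n\<le>m. T n)"
      by (rule DERIV_imp_deriv)
    \<comment> \<open>At n = 0 the inner sum is empty, (z)_0 being constant; at the other even n the
      coefficient vanishes.\<close>
    have "T n = 0" if "even n" for n
      using that boole_coeff_even_eq_0[of n] by (cases "n = 0") (auto simp: T_def)
    hence "(\<Sum>n\<le>m. T n) = T 1 + (\<Sum>k=1..K. T (2*k+1))"
      unfolding m_def by (rule sum_vanishing_even)
    \<comment> \<open>\<open>boole_coeff 1\<close> is 1/2 and (z)_1 has derivative 1; the outer
      factor 1/2 then yields the leading 1/4.\<close>
    moreover have "q powr (-s) * T 1 = 1/2 * q powr (-s - 1)"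
      unfolding T_def boole_coeff_1 using powr_minus_of_nat[OF q0, of s 1] by simp
    moreover have "q powr (-s) * T (2*k+1) = - (euler_poly (2*k+1) 0
                   * (\<Sum>j=0..2*k. pochhammer s j / (fact j * of_nat (2*k - j + 1)))
                   * q powr (-s - of_nat (2*k) - 1))" for k
    proof -
      have 1: "q powr (-s - of_nat (2*k) - 1) = q powr (-s) * (1 / q) ^ (2*k+1)"
        using powr_minus_of_nat[OF q0, of s "2*k+1"] by (simp add: algebra_simps)
      have 2: "(\<Sum>j=0..2*k. pochhammer s j / (fact j * of_nat (2*k - j + 1))) = 
            (\<Sum>j<2*k+1. pochhammer s j / (fact j * of_nat (2*k + 1 - j)))"
        by (intro sum.cong) (auto simp: Suc_diff_le)
      \<comment> \<open>The factor n! from the derivative of (z)_n turns the Taylor coefficient into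
        the value of the Euler polynomial.\<close>
      have 3: "euler_poly (2*k+1) 0 = - (boole_coeff (2*k+1) * fact (2*k+1))"
        by (subst boole_coeff_eq_euler_poly) (auto simp del: fact_Suc)
      show ?thesis unfolding 1 2 3 T_def by (simp only: mult_ac mult_minus_left mult_minus_right minus_minus)
    qed
    ultimately have sum_T: "q powr (-s) * (\<Sum>n\<le>m. T n) = 1/2 * q powr (-s - 1) -
       (\<Sum>k=1..K. euler_poly (2*k+1) 0
                   * (\<Sum>j=0..2*k. pochhammer s j / (fact j * of_nat (2*k - j + 1)))
                   * q powr (-s - of_nat (2*k) - 1))"
      by (simp add: distrib_left sum_distrib_left sum_negf)
    have "q powr (-s) * q powr s = 1" using q0 by (simp add: powr_minus)
    \<comment> \<open>Multiplication by q^(-s) undoes the normalisation by q^z at z = s.\<close>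
    hence "q powr (-s) * deriv P s = deriv (\<lambda>z. zeta_E z q) s + zeta_E s q * Ln q - 1/2 * (q powr (-s) * (\<Sum>n\<le>m. T n))"
      unfolding deriv_P by algebra
    also have "\<dots> = ?E q"
      unfolding sum_T by (simp add: algebra_simps)
    finally have "norm (?E q) = norm (q powr (-s)) * norm (deriv P s)"
      by (simp flip: norm_mult)
    also have "\<dots> \<le> (norm q powr (- Re s) * exp (pi * norm s)) * (D * norm q powr (- real (Suc m)))"
      using norm_powr_le[of q "-s"] deriv_P_bound by (intro mult_mono) auto
    also have "\<dots> = exp (pi * norm s) * D * (norm q powr (- Re s) * norm q powr (- real (Suc m)))"
      by (simp only: mult_ac)
    also have "norm q powr (- Re s) * norm q powr (- real (Suc m)) = norm q powr (-Re s - 2 * real K - 3)"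
      unfolding powr_add [symmetric] by (rule arg_cong [where f = "\<lambda>x. norm q powr x"]) (simp add: m_def)
    finally show ?thesis .
  qed
  show ?thesis
  proof (rule bigoI)
    show "\<forall>\<^sub>F q in inf at_infinity (principal {q. \<bar>Arg q\<bar> \<le> pi - \<delta>}).
       norm (?E q) \<le> (exp (pi * norm s) * D) * norm (complex_of_real (norm q powr (-Re s - 2 * real K - 3)))"
      unfolding eventually_inf_principal eventually_at_infinity
    proof (intro exI allI impI)
      fix q :: complex
      assume "2 / c \<le> norm q" "q \<in> {q. \<bar>Arg q\<bar> \<le> pi - \<delta>}"
      hence "q \<in> far_sector c" by (intro far) auto
      from main[OF this] show "norm (?E q) \<le> (exp (pi * norm s) * D) * norm (complex_of_real (norm q powr (-Re s - 2 * real K - 3)))"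
        by simp
    qed
  qed
qed

end
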